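(* Assume that $\lambda>\max\{0,2\sigma\}$ and let $x\in\mathbb{R}^d$. Let $\bar u\in U^\Delta$ satisfy the following: for any $k\in\mathbb{N}$ and $t\in I_k$, $$\bar u(t)\in\operatorname*{arg\,min}_{u=(u_1,\dots,u_m)\in U}\left\{\int_{I_k}\langle\bar\varphi(s),Bu\rangle\,ds+\gamma b_k\|u\|_p^q\right\},$$ where $\bar y$ is the trajectory corresponding to $\bar u$ and $\bar\varphi$ is the adjoint state associated to $(\bar y,\bar u)$. Then $\bar u$ is a minimizer of $J^\Delta(x,\cdot)$ over $U^\Delta$, i.e. $$J^\Delta(x,u)\ge J^\Delta(x,\bar u)\quad\text{for all }u\in U^\Delta.$$
   Context: Parameters: $0<p<1$, $q\in[p,1]$, $\gamma>0$, $y_d\in\mathbb{R}^d$; $U\subset\mathbb{R}^m$ is compact and convex; $\mathbb{N}=\{0,1,2,\dots\}$; $\|u\|_p=(\sum_{i=1}^m|u_i|^p)^{1/p}$ for $u\in\mathbb{R}^m$. Let $A\in\mathbb{R}^{d\times d}$, $B\in\mathbb{R}^{d\times m}$; $\sigma=\sup\{\operatorname{Re}\mu:\mu\text{ an eigenvalue of }A\}$. The trajectory corresponding to a control $u$ is the solution of $\dot y(t)=Ay(t)+Bu(t)$, $y(0)=x$. Temporal grid: $0=t_0<t_1<\cdots<t_k<t_{k+1}<\cdots$ with $t_k\to\infty$, $I_k=[t_k,t_{k+1})$, $b_k=\int_{I_k}e^{-\lambda t}dt$. $U^\Delta$ is the set of $u\in L^\infty(0,\infty;U)$ that are constant on each $I_k$,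 with $u_i(t)=u_{i,k}$ for $t\in I_k$. The cost is $$J^\Delta(x,u)=\int_0^\infty\tfrac12e^{-\lambda t}\|y(t)-y_d\|_2^2\,dt+\gamma\sum_{k=0}^\infty b_k\Big(\sum_{i=1}^m|u_{i,k}|^p\Big)^{q/p}.$$ Adjoint state: $L^2_\lambda(0,\infty;\mathbb{R}^d)$ denotes the space of measurable $z:(0,\infty)\to\mathbb{R}^d$ with $\int_0^\infty e^{\lambda t}\|z(t)\|_2^2\,dt<\infty$. For $(y,u)$ satisfying the state equation with $u\in U^\Delta$, the adjoint state $\varphi$ associated to $(y,u)$ is the unique function with $\varphi,\dot\varphi\in L^2_\lambda(0,\infty;\mathbb{R}^d)$ solving $-\dot\varphi(t)=A^T\varphi(t)+e^{-\lambda t}(y(t)-y_d)$ for $t>0$, $\lim_{t\to\infty}\varphi(t)=0$. *)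

theory Defs
  imports "HOL-Analysis.Analysis"
begin

(* The mu range over the complex numbers although A is real; the set is finite and
   nonempty, so that the supremum in real is the maximum. *)
definition complex_eigenvalue :: "real^'d^'d \<Rightarrow> complex \<Rightarrow> bool" where
  "complex_eigenvalue A \<mu> \<longleftrightarrow>
     (\<exists>v :: complex^'d. v \<noteq> 0 \<and> (\<chi> i j. complex_of_real (A $ i $ j)) *v v = \<mu> *s v)"

definition spectral_abscissa :: "real^'d^'d \<Rightarrow> real" where
  "spectral_abscissa A = (SUP \<mu>\<in>{\<mu>. complex_eigenvalue A \<mu>}. Re \<mu>)"

definition lp_norm :: "real \<Rightarrow> real^'m \<Rightarrow> real" where
  "lp_norm p u = (\<Sum>i\<in>UNIV. \<bar>u $ i\<bar> powr p) powr (1 / p)"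

definition cell :: "(nat \<Rightarrow> real) \<Rightarrow> nat \<Rightarrow> real set" where
  "cell t k = {t k ..< t (Suc k)}"

definition weight :: "real \<Rightarrow> (nat \<Rightarrow> real) \<Rightarrow> nat \<Rightarrow> real" where
  "weight lam t k = (LINT s:cell t k|lborel. exp (- lam * s))"

(* Controls are represented by their piecewise constant representatives. When U is bounded
   and the cells cover [0,\<infinity>), measurability and boundedness are automatic.
   Values at negative times are irrelevant. *)
definition grid_controls :: "(nat \<Rightarrow> real) \<Rightarrow> (real^'m) set \<Rightarrow> (real \<Rightarrow> real^'m) set" where
  "grid_controls t U =
     {u. (\<forall>s\<ge>0. u s \<in> U) \<and> (\<forall>k. u constant_on cell t k)}"

(* A control may jump at grid points, so the initial value problem y' = A y + B u, y(0) = x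
   is understood in the Caratheodory (integrated) sense on [0,\<infinity>). *)
definition is_trajectory ::
    "real^'d^'d \<Rightarrow> real^'m^'d \<Rightarrow> real^'d \<Rightarrow> (real \<Rightarrow> real^'m) \<Rightarrow> (real \<Rightarrow> real^'d) \<Rightarrow> bool" where
  "is_trajectory A B x u y \<longleftrightarrow>
     (\<forall>T\<ge>0. ((\<lambda>s. A *v y s + B *v u s) has_integral (y T - x)) {0..T})"

(* The choice concerns only irrelevant negative times:
   see is_trajectory_trajectory and is_trajectory_unique below. *)
definition trajectory ::
    "real^'d^'d \<Rightarrow> real^'m^'d \<Rightarrow> real^'d \<Rightarrow> (real \<Rightarrow> real^'m) \<Rightarrow> real \<Rightarrow> real^'d" where
  "trajectory A B x u = (SOME y. is_trajectory A B x u y)"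

(* All terms of the cost are nonnegative, so it is defined in ennreal, without presupposing
   convergence. The value of u on the k-th cell is u (t k). *)
definition cost ::
    "real^'d^'d \<Rightarrow> real^'m^'d \<Rightarrow> real^'d \<Rightarrow> real \<Rightarrow> real \<Rightarrow> real \<Rightarrow> real \<Rightarrow> (nat \<Rightarrow> real) \<Rightarrow>
     real^'d \<Rightarrow> (real \<Rightarrow> real^'m) \<Rightarrow> ennreal" where
  "cost A B yd lam \<gamma> p q t x u =
     (\<integral>\<^sup>+s\<in>{0..}. ennreal (1/2 * exp (- lam * s) * (norm (trajectory A B x u s - yd))\<^sup>2) \<partial>lborel)
     + ennreal \<gamma> *
       (\<Sum>k. ennreal (weight lam t k * (\<Sum>i\<in>UNIV. \<bar>u (t k) $ i\<bar> powr p) powr (q / p)))"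

definition weighted_L2 :: "real \<Rightarrow> (real \<Rightarrow> real^'d) set" where
  "weighted_L2 lam =
     {z. set_borel_measurable lborel {0<..} z \<and>
         (\<integral>\<^sup>+s\<in>{0<..}. ennreal (exp (lam * s) * (norm (z s))\<^sup>2) \<partial>lborel) < \<infinity>}"

(* Because y is continuous, the right-hand side of the adjoint equation is continuous, and the
   equation holds in the classical sense. *)
definition is_adjoint_state ::
    "real^'d^'d \<Rightarrow> real^'d \<Rightarrow> real \<Rightarrow> (real \<Rightarrow> real^'d) \<Rightarrow> (real \<Rightarrow> real^'d) \<Rightarrow> bool" where
  "is_adjoint_state A yd lam y \<phi> \<longleftrightarrow>
     (\<exists>\<phi>'. \<phi> \<in> weighted_L2 lam \<and> \<phi>' \<in> weighted_L2 lam \<and>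
        (\<forall>s>0. (\<phi> has_vector_derivative \<phi>' s) (at s)) \<and>
        (\<forall>s>0. - \<phi>' s = transpose A *v \<phi> s + exp (- lam * s) *\<^sub>R (y s - yd))) \<and>
     (\<phi> \<longlongrightarrow> 0) at_top"

lemma volterra_iterate_bound:
  fixes A :: "real^'d^'d"
  assumes "\<And>n. continuous_on {0..T} (w n)"
    and "\<And>n s. s \<in> {0..T} \<Longrightarrow> w (Suc n) s = integral {0..s} (\<lambda>r. A *v w n r)"
    and "\<And>s. s \<in> {0..T} \<Longrightarrow> norm (w 0 s) \<le> M"
    and "s \<in> {0..T}"
  shows "norm (w n s) \<le> M * (onorm ((*v) A) * s) ^ n / fact n"
  using assms(4)
proof (induction n arbitrary: s)
  case 0
  then show ?case using assms(3) by simp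
next
  case (Suc n)
  let ?K = "onorm ((*v) A)"
  have "0 \<le> s" "s \<le> T" using Suc.prems by auto
  have cont: "continuous_on {0..s} (w n)"
    by (rule continuous_on_subset[OF assms(1)]) (use \<open>s \<le> T\<close> in auto)
  have int: "((\<lambda>r. ?K * (M * (?K * r) ^ n / fact n)) has_integral
               (M * (?K * s) ^ Suc n / fact (Suc n) - M * (?K * 0) ^ Suc n / fact (Suc n))) {0..s}"
  proof (rule fundamental_theorem_of_calculus[OF \<open>0 \<le> s\<close>])
    fix r :: real
    have "((\<lambda>r. M * (?K * r) ^ Suc n / fact (Suc n)) has_real_derivative
            M * (real (Suc n) * (?K * r) ^ n * ?K) / fact (Suc n)) (at r within {0..s})"
      by (rule derivative_eq_intros refl | simp)+
    also have "M * (real (Suc n) * (?K * r) ^ n * ?K) / fact (Suc n) =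
                 ?K * (M * (?K * r) ^ n / fact n)"
      by (simp add: divide_simps del: of_nat_Suc)
    finally show "((\<lambda>r. M * (?K * r) ^ Suc n / fact (Suc n)) has_vector_derivative
                    ?K * (M * (?K * r) ^ n / fact n)) (at r within {0..s})"
      by (simp add: has_real_derivative_iff_has_vector_derivative)
  qed
  have "norm (integral {0..s} (\<lambda>r. A *v w n r)) \<le>
          integral {0..s} (\<lambda>r. ?K * (M * (?K * r) ^ n / fact n))"
  proof (rule integral_norm_bound_integral)
    show "(\<lambda>r. A *v w n r) integrable_on {0..s}"
      using cont by (intro integrable_continuous_interval bounded_linear.continuous_on[OF matrix_vector_mul_bounded_linear])
    show "(\<lambda>r. ?K * (M * (?K * r) ^ n / fact n)) integrable_on {0..s}"
      using int by blast
    fix r assume r: "r \<in> {0..s}"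
    have "norm (A *v w n r) \<le> ?K * norm (w n r)"
      by (rule onorm[OF matrix_vector_mul_bounded_linear])
    also have "\<dots> \<le> ?K * (M * (?K * r) ^ n / fact n)"
      using r \<open>s \<le> T\<close> by (intro mult_left_mono Suc.IH onorm_pos_le matrix_vector_mul_bounded_linear) auto
    finally show "norm (A *v w n r) \<le> ?K * (M * (?K * r) ^ n / fact n)" .
  qed
  then show ?case
    using integral_unique[OF int] assms(2)[OF Suc.prems] by simp
qed

lemma summable_exp_majorant: "summable (\<lambda>n. M * (K :: real) ^ n / fact n)"
  using summable_mult[OF summable_exp[of K], of M] by (simp add: field_simps)

lemma is_trajectory_exists:
  fixes A :: "real^'d^'d" and B :: "real^'m^'d"
  assumes "\<And>T. 0 \<le> T \<Longrightarrow> (\<lambda>s. B *v u s) integrable_on {0..T}"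
  shows "\<exists>y. is_trajectory A B x u y"
proof -
  let ?K = "onorm ((*v) A)"
  define w where "w = rec_nat (\<lambda>s. x + integral {0..s} (\<lambda>r. B *v u r))
                       (\<lambda>_ v s. integral {0..s} (\<lambda>r. A *v v r))"
  have w0: "w 0 s = x + integral {0..s} (\<lambda>r. B *v u r)" for s by (simp add: w_def)
  have wS: "w (Suc n) s = integral {0..s} (\<lambda>r. A *v w n r)" for n s by (simp add: w_def)
  have cont: "continuous_on {0..T} (w n)" if "0 \<le> T" for n T
  proof (induction n)
    case 0
    show ?case unfolding w0
      by (intro continuous_intros indefinite_integral_continuous_1 assms that)
  next
    case (Suc n)
    show ?case unfolding wS
      by (intro indefinite_integral_continuous_1 integrable_continuous_interval
          bounded_linear.continuous_on[OF matrix_vector_mul_bounded_linear] Suc)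
  qed
  define y where "y s = (\<Sum>n. w n s)" for s
  have "((\<lambda>s. A *v y s + B *v u s) has_integral (y T - x)) {0..T}" if T: "0 \<le> T" for T
  proof -
    have "compact (w 0 ` {0..T})"
      using cont[OF T] by (intro compact_continuous_image) auto
    then obtain M0 where M0: "\<forall>v\<in>w 0 ` {0..T}. norm v \<le> M0"
      using compact_imp_bounded bounded_iff by blast
    define M where "M = max 0 M0"
    have M: "norm (w 0 s) \<le> M" if "s \<in> {0..T}" for s using that M0 by (force simp: M_def)
    have bound: "norm (w n s) \<le> M * (?K * T) ^ n / fact n" if s: "s \<in> {0..T}" for n s
    proof -
      have "norm (w n s) \<le> M * (?K * s) ^ n / fact n"
        by (rule volterra_iterate_bound[OF cont[OF T] wS M s])
      also have "\<dots> \<le> M * (?K * T) ^ n / fact n"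
        using s by (intro divide_right_mono mult_left_mono power_mono)
          (auto simp: M_def onorm_pos_le[OF matrix_vector_mul_bounded_linear])
      finally show ?thesis .
    qed
    have ul: "uniform_limit {0..T} (\<lambda>n s. \<Sum>i<n. w i s) y sequentially"
      unfolding y_def using bound by (rule Weierstrass_m_test[OF _ summable_exp_majorant])
    have ulA: "uniform_limit {0..T} (\<lambda>n s. A *v (\<Sum>i<n. w i s)) (\<lambda>s. A *v y s) sequentially"
      by (rule bounded_linear.uniform_limit[OF matrix_vector_mul_bounded_linear ul])
    have contA: "continuous_on {0..T} (\<lambda>s. A *v (\<Sum>i<n. w i s))" for n
      by (intro bounded_linear.continuous_on[OF matrix_vector_mul_bounded_linear] continuous_on_sum cont T)
    obtain I J where I: "\<And>n. ((\<lambda>s. A *v (\<Sum>i<n. w i s)) has_integral I n) {0..T}"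
      and J: "((\<lambda>s. A *v y s) has_integral J) {0..T}" and IJ: "I \<longlonglongrightarrow> J"
      using uniform_limit_integral[OF ulA contA] by auto
    have In: "I n = (\<Sum>i<Suc n. w i T) - w 0 T" for n
    proof -
      have "((\<lambda>s. \<Sum>i<n. A *v w i s) has_integral (\<Sum>i<n. w (Suc i) T)) {0..T}"
        unfolding wS
        by (intro has_integral_sum finite_lessThan integrable_integral integrable_continuous_interval
            bounded_linear.continuous_on[OF matrix_vector_mul_bounded_linear] cont T)
      then have "I n = (\<Sum>i<n. w (Suc i) T)"
        using I[of n] has_integral_unique
        by (auto simp: linear_sum[OF matrix_vector_mul_linear])
      then show ?thesis by (simp add: sum.lessThan_Suc_shift del: sum.lessThan_Suc)
    qed
    have "(\<lambda>n. \<Sum>i<n. w i T) \<longlonglongrightarrow> y T"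
      using tendsto_uniform_limitI[OF ul, of T] T by simp
    then have "(\<lambda>n. (\<Sum>i<Suc n. w i T) - w 0 T) \<longlonglongrightarrow> y T - w 0 T"
      by (intro tendsto_diff tendsto_const LIMSEQ_Suc)
    then have "J = y T - w 0 T"
      using IJ unfolding In by (rule LIMSEQ_unique[symmetric])
    then have "J + integral {0..T} (\<lambda>r. B *v u r) = y T - x" by (simp add: w0)
    then show ?thesis
      using has_integral_add[OF J integrable_integral[OF assms[OF T]]] by simp
  qed
  then show ?thesis unfolding is_trajectory_def by blast
qed

lemma is_trajectory_continuous:
  assumes "is_trajectory A B x u y" and "0 \<le> T"
  shows "continuous_on {0..T} y"
proof -
  let ?f = "\<lambda>s. A *v y s + B *v u s"
  have "continuous_on {0..T} (\<lambda>s. x + integral {0..s} ?f)"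
    using assms unfolding is_trajectory_def
    by (intro continuous_intros indefinite_integral_continuous_1) blast
  moreover have "x + integral {0..s} ?f = y s" if "s \<in> {0..T}" for s
    using assms(1) that integral_unique[of ?f "y s - x" "{0..s}"] by (simp add: is_trajectory_def)
  ultimately show ?thesis by (rule continuous_on_eq)
qed

lemma is_trajectory_unique:
  assumes "is_trajectory A B x u y" and "is_trajectory A B x u z" and "0 \<le> T"
  shows "y T = z T"
proof -
  let ?K = "onorm ((*v) A)"
  define w where "w s = y s - z s" for s
  have cont: "continuous_on {0..T} w"
    unfolding w_def using assms by (intro continuous_intros is_trajectory_continuous)
  have wI: "w s = integral {0..s} (\<lambda>r. A *v w r)" if "s \<in> {0..T}" for s
  proof -
    have "((\<lambda>r. (A *v y r + B *v u r) - (A *v z r + B *v u r)) has_integral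
            (y s - x) - (z s - x)) {0..s}"
      using assms(1,2) that unfolding is_trajectory_def by (intro has_integral_diff) auto
    then have "((\<lambda>r. A *v w r) has_integral w s) {0..s}"
      by (simp add: w_def matrix_vector_mult_diff_distrib)
    then show ?thesis by (simp add: integral_unique)
  qed
  have "compact (w ` {0..T})" using cont by (intro compact_continuous_image) auto
  then obtain M where M: "\<forall>v\<in>w ` {0..T}. norm v \<le> M"
    using compact_imp_bounded bounded_iff by blast
  have "norm (w T) \<le> M * (?K * T) ^ n / fact n" for n
    using volterra_iterate_bound[of T "\<lambda>_. w" A M T n] cont wI M assms(3) by auto
  then have "norm (w T) \<le> 0"
    by (intro LIMSEQ_le_const[OF summable_LIMSEQ_zero[OF summable_exp_majorant]]) blast
  then show ?thesis by (simp add: w_def)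
qed

lemma grid_controls_integrable:
  fixes B :: "real^'m^'d"
  assumes "u \<in> grid_controls t U" and "t 0 = 0" and "strict_mono t"
    and "filterlim t at_top sequentially"
  shows "(\<lambda>s. B *v u s) integrable_on {0..T}"
proof -
  have cell: "(\<lambda>s. B *v u s) integrable_on {t k..t (Suc k)}" for k
  proof -
    obtain c where c: "\<And>s. s \<in> cell t k \<Longrightarrow> u s = c"
      using assms(1) unfolding grid_controls_def constant_on_def by blast
    show ?thesis
      by (rule integrable_spike_finite[of "{t (Suc k)}" _ _ "\<lambda>_. B *v c"])
        (auto simp: cell_def intro!: arg_cong[where f = "(*v) B"] c)
  qed
  have "(\<lambda>s. B *v u s) integrable_on {0..t k}" for k
  proof (induction k)
    case 0
    then show ?case using assms(2) integrable_on_refl[of _ "0 :: real"] by simp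
  next
    case (Suc k)
    have "0 \<le> t k" "t k \<le> t (Suc k)"
      using assms(2) strict_mono_less_eq[OF assms(3)] by (metis le0, simp)
    then show ?case using Suc cell[of k] by (rule Henstock_Kurzweil_Integration.integrable_combine)
  qed
  moreover obtain k where "T \<le> t k"
    using assms(4) unfolding filterlim_at_top by (meson eventually_happens' sequentially_bot)
  ultimately show ?thesis
    using integrable_on_subinterval[of _ "{0..t k}" 0 T] by auto
qed

lemma is_trajectory_trajectory:
  assumes "u \<in> grid_controls t U" and "t 0 = 0" and "strict_mono t"
    and "filterlim t at_top sequentially"
  shows "is_trajectory A B x u (trajectory A B x u)"
  unfolding trajectory_def
  by (rule someI_ex[OF is_trajectory_exists[OF grid_controls_integrable[OF assms]]])

end

theory Submission imports Defs begin

text \<open>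
  Let \<open>w\<close> be the difference of the trajectories \<open>z\<close> of \<open>u\<close> and \<open>y\<close> of \<open>ubar\<close>. Integrating the
  derivative of \<open>phibar \<bullet> w\<close> over the half-line shows that the derivative of the quadratic part of the
  cost in the direction \<open>w\<close> equals the integral of \<open>phibar \<bullet> (B *v (u - ubar))\<close>. By minimality on each
  cell, the latter is at least the decrease of the penalty, and the quadratic part is convex.

  The boundary term at infinity vanishes without any estimate on the matrix exponential: if \<open>u\<close> has
  finite cost then \<open>z - yd\<close> lies in the space with weight \<open>exp (- lam * s)\<close>, and \<open>y - yd\<close> does so by
  the adjoint equation. Hence \<open>phibar \<bullet> w\<close> and its derivative are integrable.
\<close>

section \<open>Exponentially weighted square-integrable functions on the half-line\<close>

text \<open>Only the functions cut off to \<open>S\<close> are known to be measurable. Composing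
  \<open>h\<close> with the cut-off functions changes values outside \<open>S\<close> alone, where
  the outer indicator vanishes. Taking one component to be \<open>s\<close> itself covers integrands
  with an explicit weight.\<close>

lemma set_borel_measurable_continuous_compose2:
  fixes f :: "'a \<Rightarrow> 'b::{second_countable_topology,real_normed_vector}"
    and g :: "'a \<Rightarrow> 'c::{second_countable_topology,real_normed_vector}"
    and h :: "'b \<times> 'c \<Rightarrow> 'e::{second_countable_topology,real_normed_vector}"
  assumes "set_borel_measurable M S f" "set_borel_measurable M S g"
    and "S \<in> sets M" and "continuous_on UNIV h"
  shows "set_borel_measurable M S (\<lambda>s. h (f s, g s))"
proof -
  have fg: "(\<lambda>s. indicator S s *\<^sub>R f s) \<in> borel_measurable M"
      "(\<lambda>s. indicator S s *\<^sub>R g s) \<in> borel_measurable M" and h: "h \<in> borel_measurable borel"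
    using assms by (auto simp: set_borel_measurable_def intro: borel_measurable_continuous_onI)
  have "(\<lambda>s. indicator S s *\<^sub>R h (indicator S s *\<^sub>R f s, indicator S s *\<^sub>R g s)) \<in> borel_measurable M"
    by (intro borel_measurable_scaleR borel_measurable_indicator assms(3)
        measurable_compose[OF borel_measurable_Pair h] fg)
  also have "(\<lambda>s. indicator S s *\<^sub>R h (indicator S s *\<^sub>R f s, indicator S s *\<^sub>R g s)) =
      (\<lambda>s. indicator S s *\<^sub>R h (f s, g s))"
    by (auto simp: fun_eq_iff indicator_def)
  finally show ?thesis by (simp add: set_borel_measurable_def)
qed

lemma set_borel_measurable_id: "S \<in> sets borel \<Longrightarrow> set_borel_measurable lborel S (\<lambda>s::real. s)"
  by (simp add: set_borel_measurable_def)

text \<open>The weighted square inherits measurability from \<open>z\<close>, so finiteness of its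
  nonnegative integral is the same as integrability. This moves the extended real definition into
  the calculus of Bochner integrals.\<close>

lemma weighted_L2_iff:
  "z \<in> weighted_L2 lam \<longleftrightarrow> set_borel_measurable lborel {0<..} z \<and>
     set_integrable lborel {0<..} (\<lambda>s. exp (lam * s) * (norm (z s))\<^sup>2)"
proof -
  have "(\<integral>\<^sup>+s\<in>{0<..}. ennreal (exp (lam * s) * (norm (z s))\<^sup>2) \<partial>lborel) < \<infinity> \<longleftrightarrow>
      set_integrable lborel {0<..} (\<lambda>s. exp (lam * s) * (norm (z s))\<^sup>2)"
    if "set_borel_measurable lborel {0<..} z"
  proof -
    have "set_borel_measurable lborel {0<..} (\<lambda>s. (\<lambda>(s, v). exp (lam * s) * (norm v)\<^sup>2) (s, z s))"
      by (intro set_borel_measurable_continuous_compose2 set_borel_measurable_id that)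
        (auto intro!: continuous_intros simp: case_prod_unfold)
    then show ?thesis
      by (simp add: set_integrable_def set_borel_measurable_def integrable_iff_bounded abs_mult
          ennreal_mult'' ennreal_indicator mult.commute)
  qed
  then show ?thesis by (auto simp: weighted_L2_def)
qed

lemma weighted_L2_bounded_by:
  assumes "z \<in> weighted_L2 lam" and "set_borel_measurable lborel {0<..} z'"
    and "\<And>s. 0 < s \<Longrightarrow> norm (z' s) \<le> c * norm (z s)"
  shows "z' \<in> weighted_L2 lam"
proof -
  have "set_integrable lborel {0<..} (\<lambda>s. c\<^sup>2 * (exp (lam * s) * (norm (z s))\<^sup>2))"
    using assms(1) by (auto simp: weighted_L2_iff)
  then have "set_integrable lborel {0<..} (\<lambda>s. exp (lam * s) * (norm (z' s))\<^sup>2)"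
  proof (rule set_integrable_bound)
    have "set_borel_measurable lborel {0<..} (\<lambda>s. (\<lambda>(s, v). exp (lam * s) * (norm v)\<^sup>2) (s, z' s))"
      by (intro set_borel_measurable_continuous_compose2 set_borel_measurable_id assms)
        (auto intro!: continuous_intros simp: case_prod_unfold)
    then show "set_borel_measurable lborel {0<..} (\<lambda>s. exp (lam * s) * (norm (z' s))\<^sup>2)" by simp
    have "(norm (z' s))\<^sup>2 \<le> c\<^sup>2 * (norm (z s))\<^sup>2" if "0 < s" for s
      using power_mono[OF assms(3)[OF that], of 2] by (simp add: power_mult_distrib)
    then show "AE s in lborel. s \<in> {0<..} \<longrightarrow> norm (exp (lam * s) * (norm (z' s))\<^sup>2)
        \<le> norm (c\<^sup>2 * (exp (lam * s) * (norm (z s))\<^sup>2))"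
      by (auto simp: abs_mult mult.left_commute[of _ "exp _"] mult_left_mono)
  qed
  then show ?thesis using assms(2) by (simp add: weighted_L2_iff)
qed

lemma weighted_L2_add:
  assumes "y \<in> weighted_L2 lam" and "z \<in> weighted_L2 lam"
  shows "(\<lambda>s. y s + z s) \<in> weighted_L2 lam"
proof -
  have yz: "set_borel_measurable lborel {0<..} y" "set_borel_measurable lborel {0<..} z"
    using assms by (auto simp: weighted_L2_iff)
  have "set_borel_measurable lborel {0<..} (\<lambda>s. (\<lambda>(v, w). v + w) (y s, z s))"
    by (intro set_borel_measurable_continuous_compose2 yz)
      (auto intro!: continuous_intros simp: case_prod_unfold)
  then have meas: "set_borel_measurable lborel {0<..} (\<lambda>s. y s + z s)" by simp
  have "set_integrable lborel {0<..}
      (\<lambda>s. 2 * (exp (lam * s) * (norm (y s))\<^sup>2) + 2 * (exp (lam * s) * (norm (z s))\<^sup>2))"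
    using assms by (auto simp: weighted_L2_iff)
  then have "set_integrable lborel {0<..} (\<lambda>s. exp (lam * s) * (norm (y s + z s))\<^sup>2)"
  proof (rule set_integrable_bound)
    have "set_borel_measurable lborel {0<..}
        (\<lambda>s. (\<lambda>(s, v). exp (lam * s) * (norm v)\<^sup>2) (s, y s + z s))"
      by (intro set_borel_measurable_continuous_compose2 set_borel_measurable_id meas)
        (auto intro!: continuous_intros simp: case_prod_unfold)
    then show "set_borel_measurable lborel {0<..} (\<lambda>s. exp (lam * s) * (norm (y s + z s))\<^sup>2)" by simp
    \<comment> \<open>The pointwise majorant comes from
      \<open>(a + b)^2 \<le> 2 * a^2 + 2 * b^2\<close>.\<close>
    have "exp (lam * s) * (norm (y s + z s))\<^sup>2 \<le>
        2 * (exp (lam * s) * (norm (y s))\<^sup>2) + 2 * (exp (lam * s) * (norm (z s))\<^sup>2)" for s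
    proof -
      have "(norm (y s + z s))\<^sup>2 \<le> (norm (y s) + norm (z s))\<^sup>2"
        by (intro power_mono norm_triangle_ineq) auto
      also have "\<dots> \<le> 2 * (norm (y s))\<^sup>2 + 2 * (norm (z s))\<^sup>2"
        using sum_squares_bound[of "norm (y s)" "norm (z s)"] by (simp add: power2_sum)
      finally have "exp (lam * s) * (norm (y s + z s))\<^sup>2 \<le>
          exp (lam * s) * (2 * (norm (y s))\<^sup>2 + 2 * (norm (z s))\<^sup>2)"
        by (intro mult_left_mono) auto
      then show ?thesis by (simp add: algebra_simps)
    qed
    then show "AE s in lborel. s \<in> {0<..} \<longrightarrow> norm (exp (lam * s) * (norm (y s + z s))\<^sup>2)
        \<le> norm (2 * (exp (lam * s) * (norm (y s))\<^sup>2) + 2 * (exp (lam * s) * (norm (z s))\<^sup>2))"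
      by (simp add: abs_mult)
  qed
  then show ?thesis using meas by (simp add: weighted_L2_iff)
qed

lemma weighted_L2_matrix_vector_mult:
  fixes A :: "real^'n^'m"
  assumes "z \<in> weighted_L2 lam"
  shows "(\<lambda>s. A *v z s) \<in> weighted_L2 lam"
proof (rule weighted_L2_bounded_by[OF assms])
  have "set_borel_measurable lborel {0<..} (\<lambda>s. (\<lambda>(v, _). A *v v) (z s, z s))"
    using assms
    by (intro set_borel_measurable_continuous_compose2)
      (auto intro!: continuous_intros bounded_linear.continuous_on[OF matrix_vector_mul_bounded_linear]
        simp: case_prod_unfold weighted_L2_iff)
  then show "set_borel_measurable lborel {0<..} (\<lambda>s. A *v z s)" by simp
  show "norm (A *v z s) \<le> onorm ((*v) A) * norm (z s)" for s
    by (rule onorm[OF matrix_vector_mul_bounded_linear])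
qed

lemma weighted_L2_uminus: "z \<in> weighted_L2 lam \<Longrightarrow> (\<lambda>s. - z s) \<in> weighted_L2 lam"
  by (simp add: weighted_L2_iff set_borel_measurable_def)

lemma weighted_L2_diff:
  "y \<in> weighted_L2 lam \<Longrightarrow> z \<in> weighted_L2 lam \<Longrightarrow> (\<lambda>s. y s - z s) \<in> weighted_L2 lam"
  using weighted_L2_add[OF _ weighted_L2_uminus, of y lam z] by simp

lemma weighted_L2_cong:
  assumes "y \<in> weighted_L2 lam" and "\<And>s. 0 < s \<Longrightarrow> y s = z s"
  shows "z \<in> weighted_L2 lam"
proof -
  have "(\<lambda>s. indicator {0<..} s *\<^sub>R y s) = (\<lambda>s. indicator {0<..} s *\<^sub>R z s)"
    using assms(2) by (auto simp: fun_eq_iff indicator_def)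
  then have "set_borel_measurable lborel {0<..} z"
    using assms(1) by (simp add: weighted_L2_iff set_borel_measurable_def)
  then show ?thesis
    using assms(2) by (intro weighted_L2_bounded_by[OF assms(1), of z 1]) auto
qed

text \<open>The squared norm contributes \<open>exp (2 * lam * s)\<close>, which turns the weight
  \<open>exp (- lam * s)\<close> into \<open>exp (lam * s)\<close>. This carries the adjoint space
  over to the space of the states.\<close>

lemma weighted_L2_exp_scaleR:
  assumes "z \<in> weighted_L2 lam"
  shows "(\<lambda>s. exp (lam * s) *\<^sub>R z s) \<in> weighted_L2 (- lam)"
proof -
  have "set_borel_measurable lborel {0<..} (\<lambda>s. (\<lambda>(s, v). exp (lam * s) *\<^sub>R v) (s, z s))"
    using assms by (intro set_borel_measurable_continuous_compose2 set_borel_measurable_id)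
      (auto intro!: continuous_intros simp: case_prod_unfold weighted_L2_iff)
  moreover have "exp (- lam * s) * (norm (exp (lam * s) *\<^sub>R z s))\<^sup>2 = exp (lam * s) * (norm (z s))\<^sup>2" for s
    by (simp add: power_mult_distrib exp_minus power2_eq_square)
  ultimately show ?thesis using assms by (simp add: weighted_L2_iff)
qed

lemma set_integrable_exp_minus:
  fixes lam :: real
  assumes "0 < lam"
  shows "set_integrable lborel {0<..} (\<lambda>s. exp (- lam * s))"
proof -
  have "(\<lambda>s. exp (- lam * s)) absolutely_integrable_on {0..}"
    using integrable_on_exp_minus_to_infinity[OF assms]
    by (intro nonnegative_absolutely_integrable_1) auto
  then have "set_integrable lborel {0..} (\<lambda>s. exp (- lam * s))"
    unfolding set_integrable_def by (subst (asm) integrable_completion) measurable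
  then show ?thesis by (rule set_integrable_subset) auto
qed

text \<open>For \<open>lam > 0\<close> the weight itself is integrable, so constants belong to the
  space and dominate. Controls with values in a compact set are covered by this.\<close>

lemma weighted_L2_bounded:
  assumes "0 < lam" and "set_borel_measurable lborel {0<..} z" and "\<And>s. 0 < s \<Longrightarrow> norm (z s) \<le> M"
  shows "z \<in> weighted_L2 (- lam)"
proof -
  \<comment> \<open>\<open>axis undefined 1\<close> serves only as some vector of norm one; the
    choice of the coordinate is immaterial.\<close>
  have "(\<lambda>s. axis undefined 1 :: real^'b) \<in> weighted_L2 (- lam)"
    using set_integrable_exp_minus[OF assms(1)]
    by (simp add: weighted_L2_iff set_borel_measurable_def)
  then show ?thesis
    by (rule weighted_L2_bounded_by[of _ _ _ M]) (use assms in auto)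
qed

text \<open>Spaces with opposite weights are in duality: the exponentials cancel in the product, and
  Young's inequality bounds it by the sum of the two weighted squares.\<close>

lemma weighted_L2_norm_mult_integrable:
  assumes "y \<in> weighted_L2 lam" and "z \<in> weighted_L2 (- lam)"
  shows "set_integrable lborel {0<..} (\<lambda>s. norm (y s) * norm (z s))"
proof (rule set_integrable_bound)
  show "set_integrable lborel {0<..}
      (\<lambda>s. exp (lam * s) * (norm (y s))\<^sup>2 + exp (- lam * s) * (norm (z s))\<^sup>2)"
    using assms by (intro set_integral_add(1)) (auto simp: weighted_L2_iff)
  have "set_borel_measurable lborel {0<..} (\<lambda>s. (\<lambda>(v, w). norm v * norm w) (y s, z s))"
    using assms by (intro set_borel_measurable_continuous_compose2)
      (auto intro!: continuous_intros simp: case_prod_unfold weighted_L2_iff)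
  then show "set_borel_measurable lborel {0<..} (\<lambda>s. norm (y s) * norm (z s))" by simp
  have "norm (y s) * norm (z s) \<le> exp (lam * s) * (norm (y s))\<^sup>2 + exp (- lam * s) * (norm (z s))\<^sup>2" for s
  proof -
    \<comment> \<open>Each factor receives the square root of its own weight; the two square roots
      multiply to one.\<close>
    define a where "a = exp (lam * s / 2) * norm (y s)"
    define b where "b = exp (- lam * s / 2) * norm (z s)"
    have "exp (lam * s) * (norm (y s))\<^sup>2 = a\<^sup>2" "exp (- lam * s) * (norm (z s))\<^sup>2 = b\<^sup>2"
      unfolding a_def b_def by (simp_all add: power_mult_distrib flip: exp_double)
    moreover have "norm (y s) * norm (z s) = a * b"
      unfolding a_def b_def by (simp add: exp_minus)
    moreover have "a * b \<le> a\<^sup>2 + b\<^sup>2"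
      using sum_squares_bound[of a b] zero_le_power2[of a] zero_le_power2[of b]
      unfolding mult.assoc by linarith
    ultimately show ?thesis by simp
  qed
  then show "AE s in lborel. s \<in> {0<..} \<longrightarrow> norm (norm (y s) * norm (z s))
      \<le> norm (exp (lam * s) * (norm (y s))\<^sup>2 + exp (- lam * s) * (norm (z s))\<^sup>2)"
    by (simp add: abs_mult)
qed

lemma weighted_L2_inner_integrable:
  assumes "y \<in> weighted_L2 lam" and "z \<in> weighted_L2 (- lam)"
  shows "set_integrable lborel {0<..} (\<lambda>s. y s \<bullet> z s)"
proof (rule set_integrable_bound[OF weighted_L2_norm_mult_integrable[OF assms]])
  have "set_borel_measurable lborel {0<..} (\<lambda>s. (\<lambda>(v, w). v \<bullet> w) (y s, z s))"
    using assms by (intro set_borel_measurable_continuous_compose2)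
      (auto intro!: continuous_intros simp: case_prod_unfold weighted_L2_iff)
  then show "set_borel_measurable lborel {0<..} (\<lambda>s. y s \<bullet> z s)" by simp
qed (auto simp: Cauchy_Schwarz_ineq2)

text \<open>Pairing with a constant unit vector, which lies in the dual space because
  \<open>lam > 0\<close>, leaves just the norm.\<close>

lemma weighted_L2_norm_integrable:
  assumes "0 < lam" and "z \<in> weighted_L2 lam"
  shows "set_integrable lborel {0<..} (\<lambda>s. norm (z s))"
proof -
  have "(\<lambda>s. axis undefined 1 :: real^'b) \<in> weighted_L2 (- lam)"
    by (rule weighted_L2_bounded[OF assms(1), of _ 1]) (auto simp: set_borel_measurable_def)
  from weighted_L2_norm_mult_integrable[OF assms(2) this] show ?thesis by simp
qed

text \<open>A nonzero limit would keep \<open>f\<close> away from zero on a whole ray, and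
  integrability would force this ray to have finite measure. This is what disposes of the boundary
  term at infinity.\<close>

lemma set_integrable_tendsto_imp_zero:
  fixes f :: "real \<Rightarrow> real"
  assumes "set_integrable lborel {a<..} f" and "(f \<longlongrightarrow> L) at_top"
  shows "L = 0"
proof (rule ccontr)
  assume "L \<noteq> 0"
  then have "eventually (\<lambda>s. \<bar>L\<bar> / 2 < \<bar>f s\<bar>) at_top"
    using order_tendstoD(1)[OF tendsto_rabs[OF assms(2)], of "\<bar>L\<bar> / 2"] by simp
  then obtain b where b: "\<And>s. b \<le> s \<Longrightarrow> \<bar>L\<bar> / 2 < \<bar>f s\<bar>"
    by (auto simp: eventually_at_top_linorder)
  \<comment> \<open>Beyond \<open>b\<close> the lower bound holds; \<open>a + 1\<close> keeps the
    closed ray inside the open ray on which \<open>f\<close> is integrable.\<close>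
  define c where "c = max b (a + 1)"
  have "set_integrable lborel {c..} f"
    using assms(1) by (rule set_integrable_subset) (auto simp: c_def)
  then have "set_integrable lborel {c..} (\<lambda>_. \<bar>L\<bar> / 2)"
    by (rule set_integrable_bound) (use b in \<open>force simp: c_def set_borel_measurable_def\<close>)+
  then have "integrable lborel (indicator {c..} :: real \<Rightarrow> real)"
    using \<open>L \<noteq> 0\<close> set_integrable_mult_right_iff[of "\<bar>L\<bar> / 2" lborel "{c..}" "\<lambda>_. 1"]
    by (simp add: set_integrable_def)
  then have "emeasure lborel {c..} < \<infinity>"
    by (simp add: integrable_indicator_iff)
  then obtain r where r: "0 \<le> r" "emeasure lborel {c..} = ennreal r"
    by (cases "emeasure lborel {c..}") auto
  \<comment> \<open>The ray of supposed measure \<open>r\<close> contains an interval of length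
    \<open>r + 1\<close>.\<close>
  have "emeasure lborel {c..c + (r + 1)} \<le> emeasure lborel {c..}"
    by (rule emeasure_mono) auto
  then show False using r by simp
qed

section \<open>The time grid and piecewise constant controls\<close>

locale time_grid =
  fixes t :: "nat \<Rightarrow> real"
  assumes grid_start: "t 0 = 0" and grid_mono: "strict_mono t"
    and grid_at_top: "filterlim t at_top sequentially"
begin

lemma grid_nonneg: "0 \<le> t k"
  using grid_start strict_mono_less_eq[OF grid_mono, of 0 k] by simp

lemma grid_le_Suc: "t k \<le> t (Suc k)"
  using strict_mono_less_eq[OF grid_mono, of k "Suc k"] by simp

lemma grid_in_cell: "t k \<in> cell t k"
  using strict_monoD[OF grid_mono, of k "Suc k"] by (simp add: cell_def)

lemma grid_eventually_ge: "\<exists>N. \<forall>n\<ge>N. T \<le> t n"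
  using grid_at_top by (auto simp: filterlim_at_top eventually_sequentially)

lemma cell_exists:
  assumes "0 \<le> s"
  shows "\<exists>k. s \<in> cell t k"
proof -
  obtain n where n: "s + 1 \<le> t n" using grid_eventually_ge by blast
  \<comment> \<open>The first grid point beyond \<open>s\<close> is the right end of its cell. It is
    not \<open>t 0 = 0\<close>, since \<open>s\<close> is nonnegative, so the left end has index
    \<open>m - 1\<close>.\<close>
  define m where "m = (LEAST n. s < t n)"
  have "s < t m" unfolding m_def by (rule LeastI[of _ n]) (use n in simp)
  moreover have "m \<noteq> 0" using \<open>s < t m\<close> assms grid_start by (intro notI) simp
  moreover have "\<not> s < t (m - 1)"
    using \<open>m \<noteq> 0\<close> not_less_Least[of "m - 1" "\<lambda>n. s < t n"] by (simp add: m_def)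
  ultimately have "s \<in> cell t (m - 1)" by (simp add: cell_def)
  then show ?thesis ..
qed

text \<open>Since the grid tends to infinity, only finitely many indices stay below
  \<open>T + 1\<close>. These points form the exceptional set when the fundamental theorem of
  calculus is applied on \<open>{0..T}\<close>.\<close>

lemma finite_grid_points: "finite (range t \<inter> {..T})"
proof -
  obtain N where N: "\<And>n. N \<le> n \<Longrightarrow> T + 1 \<le> t n" using grid_eventually_ge by blast
  have "range t \<inter> {..T} \<subseteq> t ` {..<N}"
  proof
    fix s assume "s \<in> range t \<inter> {..T}"
    then obtain n where n: "s = t n" "t n \<le> T" by auto
    then have "n < N" using N[of n] by (cases "N \<le> n") auto
    then show "s \<in> t ` {..<N}" using n by blast
  qed
  then show ?thesis by (rule finite_subset) simp
qed

lemma grid_control_eq: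
  assumes "u \<in> grid_controls t U" and "s \<in> cell t k"
  shows "u s = u (t k)"
proof -
  obtain c where "\<And>r. r \<in> cell t k \<Longrightarrow> u r = c"
    using assms(1) unfolding grid_controls_def constant_on_def by blast
  then show ?thesis using assms(2) grid_in_cell by simp
qed

lemma grid_control_measurable:
  assumes "u \<in> grid_controls t U"
  shows "set_borel_measurable lborel {0<..} u"
proof -
  have "(\<lambda>s. indicator {0<..} s *\<^sub>R u s) \<in> borel_measurable lborel"
  proof (rule measurable_piecewise_restrict2)
    \<comment> \<open>A countable Borel cover of the line: index 0 takes the negative times, where
      the indicator makes the function zero, and the cells are shifted by one.\<close>
    let ?A = "\<lambda>n. case n of 0 \<Rightarrow> {..<0} | Suc k \<Rightarrow> cell t k"
    show "?A n \<in> sets lborel" for n by (cases n) (auto simp: cell_def)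
    have "s \<in> (\<Union>n. ?A n)" for s
    proof (cases "s < 0")
      case True
      then show ?thesis by (intro UN_I[of 0]) auto
    next
      case False
      then obtain k where "s \<in> cell t k" using cell_exists[of s] by auto
      then show ?thesis by (intro UN_I[of "Suc k"]) auto
    qed
    then show "space lborel = (\<Union>n. ?A n)" by auto
    show "\<exists>h\<in>borel_measurable lborel. \<forall>s\<in>?A n. indicator {0<..} s *\<^sub>R u s = h s" for n
    proof (cases n)
      case 0
      then show ?thesis by (intro bexI[of _ "\<lambda>_. 0"]) (auto simp: indicator_def)
    next
      case (Suc k)
      then show ?thesis
        by (intro bexI[of _ "\<lambda>s. indicator {0<..} s *\<^sub>R u (t k)"]) (auto simp: grid_control_eq[OF assms])
    qed
  qed
  then show ?thesis by (simp add: set_borel_measurable_def)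
qed

text \<open>Away from the grid points, \<open>s\<close> is interior to its cell, so the control is
  locally constant.\<close>

lemma grid_control_isCont:
  assumes "u \<in> grid_controls t U" and "0 \<le> s" and "s \<notin> range t"
  shows "isCont u s"
proof -
  obtain k where k: "s \<in> cell t k" using cell_exists assms(2) by blast
  then have "s \<in> {t k<..<t (Suc k)}" using assms(3) by (auto simp: cell_def order_le_less)
  then have "eventually (\<lambda>r. r \<in> {t k<..<t (Suc k)}) (nhds s)"
    by (intro eventually_nhds_in_open) auto
  then have "eventually (\<lambda>r. u r = u (t k)) (nhds s)"
    by eventually_elim (auto intro!: grid_control_eq[OF assms(1)] simp: cell_def)
  then show ?thesis by (subst isCont_cong) auto
qed

lemma grid_trajectory:
  "u \<in> grid_controls t U \<Longrightarrow> is_trajectory A B x u (trajectory A B x u)"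
  by (rule is_trajectory_trajectory[OF _ grid_start grid_mono grid_at_top])

text \<open>The intervals \<open>{0..<t N}\<close> are disjoint unions of the first \<open>N\<close>
  cells and increase to the half-line. The first cell contains the point 0, a null set that does not
  affect the integrals.\<close>

lemma cell_integrals_tendsto:
  fixes f :: "real \<Rightarrow> 'a::{banach,second_countable_topology}"
  assumes "set_integrable lborel {0<..} f"
  shows "(\<lambda>N. \<Sum>k<N. LINT s:cell t k|lborel. f s) \<longlonglongrightarrow> (LINT s:{0<..}|lborel. f s)"
proof -
  have "set_integrable lborel {0<..} f \<longleftrightarrow> set_integrable lborel {0..} f"
    by (rule set_integrable_discrete_difference[of "{0}"]) auto
  then have f: "set_integrable lborel {0..} f" using assms by simp
  have sub: "set_integrable lborel {a..<b} f" if "0 \<le> a" for a b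
    using f by (rule set_integrable_subset) (use that in auto)
  have un: "(\<Union>N. {0..<t N}) = {0..}"
  proof (intro set_eqI iffI)
    fix s :: real assume "s \<in> {0..}"
    moreover obtain N where "s + 1 \<le> t N" using grid_eventually_ge by blast
    ultimately show "s \<in> (\<Union>N. {0..<t N})" by (intro UN_I[of N]) auto
  qed auto
  have "(\<lambda>N. LINT s:{0..<t N}|lborel. f s) \<longlonglongrightarrow> (LINT s:(\<Union>N. {0..<t N})|lborel. f s)"
    by (rule set_integral_cont_up)
      (auto simp: un f incseq_def intro: order_less_le_trans strict_mono_leD[OF grid_mono])
  moreover have "(LINT s:{0..<t N}|lborel. f s) = (\<Sum>k<N. LINT s:cell t k|lborel. f s)" for N
  proof (induction N)
    case 0
    then show ?case by (simp add: grid_start set_lebesgue_integral_def)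
  next
    case (Suc N)
    have "{0..<t (Suc N)} = {0..<t N} \<union> cell t N"
      using grid_nonneg[of N] grid_le_Suc[of N] by (auto simp: cell_def)
    then have "(LINT s:{0..<t (Suc N)}|lborel. f s) =
        (LINT s:{0..<t N}|lborel. f s) + (LINT s:cell t N|lborel. f s)"
      using sub[of "t N" "t (Suc N)"] sub[of 0 "t N"] grid_nonneg[of N]
      by (simp add: set_integral_Un cell_def ivl_disj_int)
    then show ?case using Suc by simp
  qed
  moreover have "(LINT s:{0..}|lborel. f s) = (LINT s:{0<..}|lborel. f s)"
    by (rule set_integral_discrete_difference[of "{0}"]) auto
  ultimately show ?thesis by (simp add: un)
qed

end

section \<open>Continuity and differentiability of trajectories\<close>

lemma is_trajectory_start:
  assumes "is_trajectory A B x u y"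
  shows "y 0 = x"
proof -
  have "((\<lambda>s. A *v y s + B *v u s) has_integral (y 0 - x)) {0..0}"
    using assms unfolding is_trajectory_def by blast
  then have "y 0 - x = 0"
    using has_integral_unique has_integral_refl(2) by (metis atLeastAtMost_singleton)
  then show ?thesis by simp
qed

lemma is_trajectory_continuous_on_atLeast:
  assumes "is_trajectory A B x u y"
  shows "continuous_on {0..} y"
  unfolding continuous_on_eq_continuous_within
proof
  fix s :: real assume s: "s \<in> {0..}"
  have "continuous (at s within {0..s + 1}) y"
    using is_trajectory_continuous[OF assms, of "s + 1"] s
    by (auto simp: continuous_on_eq_continuous_within)
  \<comment> \<open>The compact interval reaches beyond \<open>s\<close>, so it has the same germ at
    \<open>s\<close> as the half-line.\<close>
  moreover have "at s within {0..} = at s within {0..s + 1}"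
    by (rule at_within_nhd[of _ "{..<s + 1}"]) auto
  ultimately show "continuous (at s within {0..}) y" by (simp add: continuous_within)
qed

text \<open>At a continuity point of the control the integrand of the integrated equation is
  continuous, because the trajectory is. The indefinite integral is therefore differentiable there,
  and the state equation holds classically.\<close>

lemma is_trajectory_has_vector_derivative:
  fixes A :: "real^'d^'d" and B :: "real^'m^'d"
  assumes "is_trajectory A B x u y" and "0 < s" and "isCont u s"
  shows "(y has_vector_derivative A *v y s + B *v u s) (at s)"
proof -
  let ?f = "\<lambda>r. A *v y r + B *v u r"
  have int: "(?f has_integral (y T - x)) {0..T}" if "0 \<le> T" for T
    using assms(1) that by (auto simp: is_trajectory_def)
  have "isCont y s"
    using is_trajectory_continuous_on_atLeast[OF assms(1)] assms(2)
    by (intro continuous_on_interior[of "{0..}"]) auto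
  then have "isCont ?f s"
    using assms(3) by (intro continuous_add bounded_linear.continuous[OF matrix_vector_mul_bounded_linear])
  then have "((\<lambda>r. integral {0..r} ?f) has_vector_derivative ?f s) (at s within ({0..s + 1} - {}))"
    using int[of "s + 1"] assms(2)
    by (intro integral_has_vector_derivative_continuous_at) (auto intro: continuous_at_imp_continuous_within)
  then have "((\<lambda>r. x + integral {0..r} ?f) has_vector_derivative ?f s) (at s within {0..s + 1})"
    by (auto intro!: derivative_eq_intros)
  then have "((\<lambda>r. x + integral {0..r} ?f) has_vector_derivative ?f s) (at s)"
    using assms(2) by (simp add: at_within_Icc_at)
  then show ?thesis
  proof (rule has_vector_derivative_transform_within_open[of _ _ _ "{0<..}"])
    show "x + integral {0..r} ?f = y r" if "r \<in> {0<..}" for r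
      using integral_unique[OF int[of r]] that by simp
  qed (use assms(2) in auto)
qed

section \<open>Integration by parts on the half-line\<close>

text \<open>The differential equation of the adjoint holds for positive times only, so its behaviour
  near 0 has to be derived. As \<open>lam > 0\<close>, the derivative is absolutely integrable, and
  its total integral bounds the distance of any value on \<open>{0<..1}\<close> from the value at
  1.\<close>

lemma weighted_L2_derivative_bounded_near_0:
  fixes \<phi> :: "real \<Rightarrow> real^'d"
  assumes "0 < lam" and "\<phi>' \<in> weighted_L2 lam"
    and deriv: "\<And>s. 0 < s \<Longrightarrow> (\<phi> has_vector_derivative \<phi>' s) (at s)"
  shows "\<exists>C. \<forall>s\<in>{0<..1}. norm (\<phi> s) \<le> C"
proof (intro exI ballI)
  fix s :: real assume s: "s \<in> {0<..1}"
  have n: "(\<lambda>r. norm (\<phi>' r)) integrable_on {0<..}"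
    using weighted_L2_norm_integrable[OF assms(1,2)] by (rule set_borel_integral_eq_integral)
  have n': "(\<lambda>r. norm (\<phi>' r)) integrable_on {s..1}"
    using s by (intro set_borel_integral_eq_integral set_integrable_subset[OF
        weighted_L2_norm_integrable[OF assms(1,2)]]) auto
  have int: "(\<phi>' has_integral (\<phi> 1 - \<phi> s)) {s..1}"
    using s by (intro fundamental_theorem_of_calculus) (auto intro!: has_vector_derivative_at_within deriv)
  have "norm (\<phi> 1 - \<phi> s) = norm (integral {s..1} \<phi>')"
    using int by (simp add: integral_unique)
  also have "\<dots> \<le> integral {s..1} (\<lambda>r. norm (\<phi>' r))"
    using int n' by (intro integral_norm_bound_integral) auto
  also have "\<dots> \<le> integral {0<..} (\<lambda>r. norm (\<phi>' r))"
    using s n n' by (intro integral_subset_le) auto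
  finally show "norm (\<phi> s) \<le> norm (\<phi> 1) + integral {0<..} (\<lambda>r. norm (\<phi>' r))"
    using norm_triangle_ineq4[of "\<phi> 1" "\<phi> 1 - \<phi> s"] by simp
qed

context time_grid
begin

text \<open>The integrand is the derivative of \<open>\<phi> s \<bullet> w s\<close> off the grid.
  The boundary term at 0 vanishes because \<open>w\<close> does and \<open>\<phi>\<close> is bounded
  near 0; the one at infinity vanishes because the product is integrable and has a limit.\<close>

lemma integral_by_parts_eq_0:
  fixes \<phi> w :: "real \<Rightarrow> real^'d"
  assumes "0 < lam" and \<phi>: "\<phi> \<in> weighted_L2 lam" and \<phi>': "\<phi>' \<in> weighted_L2 lam"
    and d\<phi>: "\<And>s. 0 < s \<Longrightarrow> (\<phi> has_vector_derivative \<phi>' s) (at s)"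
    and w: "w \<in> weighted_L2 (- lam)" and w': "w' \<in> weighted_L2 (- lam)"
    and dw: "\<And>s. 0 < s \<Longrightarrow> s \<notin> range t \<Longrightarrow> (w has_vector_derivative w' s) (at s)"
    and cw: "continuous_on {0..} w" and "w 0 = 0"
  shows "(LINT s:{0<..}|lborel. \<phi> s \<bullet> w' s + \<phi>' s \<bullet> w s) = 0"
proof -
  define g where "g s = \<phi> s \<bullet> w' s + \<phi>' s \<bullet> w s" for s
  \<comment> \<open>Nothing is known about \<open>\<phi> 0\<close>. Setting the value 0 there gives
    the continuous extension of the product.\<close>
  define F where "F s = (if s = 0 then 0 else \<phi> s \<bullet> w s)" for s
  have "set_integrable lborel {0<..} g"
    unfolding g_def by (intro set_integral_add(1) weighted_L2_inner_integrable[OF \<phi> w']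
        weighted_L2_inner_integrable[OF \<phi>' w])
  moreover have "set_integrable lborel {0<..} g \<longleftrightarrow> set_integrable lborel {0..} g"
    by (rule set_integrable_discrete_difference[of "{0}"]) auto
  ultimately have g: "set_integrable lborel {0..} g" by simp
  have dF: "(F has_vector_derivative g s) (at s)" if "0 < s" "s \<notin> range t" for s
  proof -
    have "((\<lambda>s. \<phi> s \<bullet> w s) has_vector_derivative g s) (at s)"
      unfolding g_def using that
      by (intro bounded_bilinear.has_vector_derivative[OF bounded_bilinear_inner] d\<phi> dw)
    then show ?thesis
      by (rule has_vector_derivative_transform_within_open[of _ _ _ "{0<..}"]) (use that in \<open>auto simp: F_def\<close>)
  qed
  have cF: "continuous_on {0..T} F" for T
    unfolding continuous_on_eq_continuous_within
  proof
    fix s assume s: "s \<in> {0..T}"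
    show "continuous (at s within {0..T}) F"
    proof (cases "s = 0")
      case True
      obtain C where C: "\<And>r. r \<in> {0<..1} \<Longrightarrow> norm (\<phi> r) \<le> C"
        using weighted_L2_derivative_bounded_near_0[OF assms(1) \<phi>' d\<phi>] by blast
      have "(w \<longlongrightarrow> w 0) (at 0 within {0..})"
        using cw by (auto simp: continuous_on_def)
      then have "((\<lambda>r. C * norm (w r)) \<longlongrightarrow> C * norm (w 0)) (at 0 within {0..T})"
        by (intro tendsto_intros) (auto elim: tendsto_within_subset)
      then have lim: "((\<lambda>r. C * norm (w r)) \<longlongrightarrow> 0) (at 0 within {0..T})"
        using assms(9) by simp
      have "eventually (\<lambda>r. r \<in> {..<1}) (at (0::real) within {0..T})"
        by (auto simp: eventually_at_filter intro!: eventually_mono[OF eventually_nhds_in_open[of "{..<1}"]])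
      moreover have "eventually (\<lambda>r. r \<in> {0..T}) (at (0::real) within {0..T})"
        by (simp add: eventually_at_filter)
      ultimately have "eventually (\<lambda>r. norm (F r) \<le> C * norm (w r)) (at 0 within {0..T})"
      proof eventually_elim
        case (elim r)
        show ?case
        proof (cases "r = 0")
          case False
          have "norm (F r) \<le> norm (\<phi> r) * norm (w r)"
            using False by (simp add: F_def Cauchy_Schwarz_ineq2)
          also have "\<dots> \<le> C * norm (w r)"
            using elim False by (intro mult_right_mono C) auto
          finally show ?thesis .
        qed (simp add: F_def assms(9))
      qed
      then have "(F \<longlongrightarrow> 0) (at 0 within {0..T})"
        by (rule Lim_null_comparison[OF _ lim])
      then show ?thesis using True by (simp add: continuous_within F_def)
    next
      case False
      then have "0 < s" using s by simp
      then have "isCont \<phi> s" using d\<phi> has_vector_derivative_continuous by blast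
      moreover have "isCont w s"
        by (rule continuous_on_interior[OF cw]) (use \<open>0 < s\<close> in simp)
      ultimately have "isCont (\<lambda>s. \<phi> s \<bullet> w s) s" by (intro continuous_intros)
      moreover have "eventually (\<lambda>r. r \<in> {0<..}) (nhds s)"
        using \<open>0 < s\<close> by (intro eventually_nhds_in_open) auto
      then have "eventually (\<lambda>r. F r = \<phi> r \<bullet> w r) (nhds s)"
        by eventually_elim (simp add: F_def)
      ultimately have "isCont F s" by (simp add: isCont_cong)
      then show ?thesis by (rule continuous_at_imp_continuous_at_within)
    qed
  qed
  have int: "(LINT s:{0..T}|lborel. g s) = F T" if "0 \<le> T" for T
  proof -
    have "(g has_integral (F T - F 0)) {0..T}"
    \<comment> \<open>The finite exceptional set contains \<open>t 0 = 0\<close>, so the derivative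
      is only claimed at positive times between grid points.\<close>
    proof (rule fundamental_theorem_of_calculus_strong[OF finite_grid_points[of T] that])
      fix s assume s: "s \<in> {0..T} - range t \<inter> {..T}"
      then have "s \<noteq> 0" using grid_start by (metis DiffE IntI atLeastAtMost_iff atMost_iff rangeI)
      then show "(F has_vector_derivative g s) (at s)" using s by (intro dF) auto
    qed (rule cF)
    moreover have "set_integrable lborel {0..T} g" using g by (rule set_integrable_subset) auto
    ultimately show ?thesis
      by (simp add: set_borel_integral_eq_integral integral_unique F_def)
  qed
  \<comment> \<open>Integrability of \<open>g\<close> provides the existence of the limit of the
    boundary term; integrability of the product then identifies it as 0.\<close>
  have "((\<lambda>T. LINT s:{0..T}|lborel. g s) \<longlongrightarrow> (LINT s:{0..}|lborel. g s)) at_top"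
    by (rule tendsto_set_lebesgue_integral_at_top[OF _ g]) auto
  moreover have "eventually (\<lambda>T. (LINT s:{0..T}|lborel. g s) = \<phi> T \<bullet> w T) at_top"
    using eventually_gt_at_top[of 0] by eventually_elim (simp add: int F_def)
  ultimately have "((\<lambda>T. \<phi> T \<bullet> w T) \<longlongrightarrow> (LINT s:{0..}|lborel. g s)) at_top"
    by (rule Lim_transform_eventually)
  then have "(LINT s:{0..}|lborel. g s) = 0"
    by (rule set_integrable_tendsto_imp_zero[OF weighted_L2_inner_integrable[OF \<phi> w]])
  moreover have "(LINT s:{0..}|lborel. g s) = (LINT s:{0<..}|lborel. g s)"
    by (rule set_integral_discrete_difference[of "{0}"]) auto
  ultimately show ?thesis by (simp add: g_def)
qed

end

section \<open>Consequences of finite cost\<close>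

lemma weight_nonneg: "0 \<le> weight lam t k"
  unfolding weight_def set_lebesgue_integral_def
  by (intro Bochner_Integration.integral_nonneg) (auto simp: indicator_def)

context time_grid
begin

text \<open>Both parts of the cost are nonnegative, so the tracking part is finite by itself. This
  yields the weighted integrability of the state without any growth bound for the
  trajectory.\<close>

lemma weighted_L2_if_finite_cost:
  fixes yd :: "real^'d"
  assumes "u \<in> grid_controls t U" and "cost A B yd lam \<gamma> p q t x u \<noteq> \<infinity>"
  shows "(\<lambda>s. trajectory A B x u s - yd) \<in> weighted_L2 (- lam)"
proof -
  let ?z = "\<lambda>s. trajectory A B x u s - yd"
  have "continuous_on {0<..} ?z"
    by (intro continuous_intros
        continuous_on_subset[OF is_trajectory_continuous_on_atLeast[OF grid_trajectory[OF assms(1)]]]) auto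
  then have meas: "set_borel_measurable lborel {0<..} ?z"
    using set_measurable_continuous_on[of "{0<..}" ?z] by (simp add: set_borel_measurable_def)
  have "(\<integral>\<^sup>+s\<in>{0..}. ennreal (1/2 * exp (- lam * s) * (norm (?z s))\<^sup>2) \<partial>lborel) \<noteq> \<infinity>"
    using assms(2) by (auto simp: cost_def)
  \<comment> \<open>The factor 2 undoes the 1/2 in the cost, and the domain shrinks by the point
    0.\<close>
  moreover have "(\<integral>\<^sup>+s\<in>{0<..}. ennreal (exp (- lam * s) * (norm (?z s))\<^sup>2) \<partial>lborel) \<le>
      (\<integral>\<^sup>+s. 2 * (ennreal (1/2 * exp (- lam * s) * (norm (?z s))\<^sup>2) * indicator {0..} s) \<partial>lborel)"
    by (intro nn_integral_mono) (auto simp: indicator_def simp flip: ennreal_numeral ennreal_mult)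
  moreover have "(\<lambda>s. ennreal (1/2 * exp (- lam * s) * (norm (?z s))\<^sup>2) * indicator {0..} s) \<in> borel_measurable lborel"
  proof -
    have "continuous_on {0..} (\<lambda>s. 1/2 * exp (- lam * s) * (norm (?z s))\<^sup>2)"
      by (intro continuous_intros is_trajectory_continuous_on_atLeast[OF grid_trajectory[OF assms(1)]])
    from borel_measurable_continuous_on_indicator[OF _ this]
    have "(\<lambda>s. ennreal (indicator {0..} s *\<^sub>R (1/2 * exp (- lam * s) * (norm (?z s))\<^sup>2))) \<in> borel_measurable lborel"
      by (intro measurable_compose[OF _ measurable_ennreal]) auto
    also have "(\<lambda>s. ennreal (indicator {0..} s *\<^sub>R (1/2 * exp (- lam * s) * (norm (?z s))\<^sup>2))) =
        (\<lambda>s. ennreal (1/2 * exp (- lam * s) * (norm (?z s))\<^sup>2) * indicator {0..} s)"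
      by (auto simp: fun_eq_iff indicator_def)
    finally show ?thesis .
  qed
  ultimately have "(\<integral>\<^sup>+s\<in>{0<..}. ennreal (exp (- lam * s) * (norm (?z s))\<^sup>2) \<partial>lborel) \<le>
        2 * (\<integral>\<^sup>+s\<in>{0..}. ennreal (1/2 * exp (- lam * s) * (norm (?z s))\<^sup>2) \<partial>lborel)"
      and "2 * (\<integral>\<^sup>+s\<in>{0..}. ennreal (1/2 * exp (- lam * s) * (norm (?z s))\<^sup>2) \<partial>lborel) < \<infinity>"
    by (simp_all only: nn_integral_cmult) (auto simp: ennreal_mult_eq_top_iff less_top[symmetric])
  then have "(\<integral>\<^sup>+s\<in>{0<..}. ennreal (exp (- lam * s) * (norm (?z s))\<^sup>2) \<partial>lborel) < \<infinity>"
    by (rule order_le_less_trans)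
  then show ?thesis using meas by (simp add: weighted_L2_def)
qed

text \<open>Once the integral and the series converge, nonnegativity lets \<open>ennreal\<close>
  commute with both of them. Costs can then be compared as real numbers.\<close>

lemma cost_eq_ennreal:
  fixes yd :: "real^'d"
  assumes "(\<lambda>s. trajectory A B x u s - yd) \<in> weighted_L2 (- lam)" and "0 \<le> \<gamma>"
    and "summable (\<lambda>k. weight lam t k * (\<Sum>i\<in>UNIV. \<bar>u (t k) $ i\<bar> powr p) powr (q / p))"
  shows "cost A B yd lam \<gamma> p q t x u = ennreal (
      (LINT s:{0<..}|lborel. 1/2 * exp (- lam * s) * (norm (trajectory A B x u s - yd))\<^sup>2) +
      \<gamma> * (\<Sum>k. weight lam t k * (\<Sum>i\<in>UNIV. \<bar>u (t k) $ i\<bar> powr p) powr (q / p)))"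
proof -
  let ?a = "\<lambda>s. 1/2 * exp (- lam * s) * (norm (trajectory A B x u s - yd))\<^sup>2"
  let ?b = "\<lambda>k. weight lam t k * (\<Sum>i\<in>UNIV. \<bar>u (t k) $ i\<bar> powr p) powr (q / p)"
  have b: "0 \<le> ?b k" for k by (simp add: weight_nonneg)
  have "set_integrable lborel {0<..} (\<lambda>s. 1/2 * (exp (- lam * s) * (norm (trajectory A B x u s - yd))\<^sup>2))"
    using assms(1) by (intro set_integrable_mult_right) (auto simp: weighted_L2_iff)
  then have "set_integrable lborel {0<..} ?a" by (simp only: mult.assoc)
  then have "integrable lborel (\<lambda>s. indicator {0<..} s *\<^sub>R ?a s)" by (simp add: set_integrable_def)
  then have "(\<integral>\<^sup>+s. ennreal (indicator {0<..} s *\<^sub>R ?a s) \<partial>lborel) = ennreal (LINT s:{0<..}|lborel. ?a s)"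
    unfolding set_lebesgue_integral_def by (rule nn_integral_eq_integral) (auto simp: indicator_def)
  moreover have "(\<integral>\<^sup>+s\<in>{0..}. ennreal (?a s) \<partial>lborel) = (\<integral>\<^sup>+s. ennreal (indicator {0<..} s *\<^sub>R ?a s) \<partial>lborel)"
  proof (rule nn_integral_cong_AE)
    show "AE s in lborel. ennreal (?a s) * indicator {0..} s = ennreal (indicator {0<..} s *\<^sub>R ?a s)"
      using AE_lborel_singleton[of "0::real"] by eventually_elim (simp add: indicator_def)
  qed
  ultimately have state: "(\<integral>\<^sup>+s\<in>{0..}. ennreal (?a s) \<partial>lborel) = ennreal (LINT s:{0<..}|lborel. ?a s)"
    by (simp only:)
  have La: "0 \<le> (LINT s:{0<..}|lborel. ?a s)"
    unfolding set_lebesgue_integral_def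
    by (rule Bochner_Integration.integral_nonneg) (simp add: indicator_def)
  have Lb: "0 \<le> (\<Sum>k. ?b k)" by (rule suminf_nonneg[OF assms(3) b])
  show ?thesis
    unfolding cost_def state suminf_ennreal2[OF b assms(3)]
    by (simp only: ennreal_plus[OF La mult_nonneg_nonneg[OF assms(2) Lb]] ennreal_mult[OF assms(2) Lb])
qed

text \<open>Because \<open>\<gamma>\<close> is positive, a divergent penalty series would make the
  cost infinite.\<close>

lemma summable_if_finite_cost:
  assumes "cost A B yd lam \<gamma> p q t x u \<noteq> \<infinity>" and "0 < \<gamma>"
  shows "summable (\<lambda>k. weight lam t k * (\<Sum>i\<in>UNIV. \<bar>u (t k) $ i\<bar> powr p) powr (q / p))"
  using assms by (intro summable_suminf_not_top)
    (auto simp: cost_def weight_nonneg ennreal_mult_eq_top_iff)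

end

section \<open>The adjoint equation and the comparison of costs\<close>

text \<open>The adjoint equation can be solved for \<open>y s - yd\<close>: it is
  \<open>exp (lam * s)\<close> times a combination of the adjoint state and its derivative, both in
  the space with weight \<open>exp (lam * s)\<close>.\<close>

lemma adjoint_state_weighted_L2:
  fixes A :: "real^'d^'d"
  assumes "is_adjoint_state A yd lam y \<phi>"
  shows "(\<lambda>s. y s - yd) \<in> weighted_L2 (- lam)"
proof -
  obtain \<phi>' where \<phi>: "\<phi> \<in> weighted_L2 lam" "\<phi>' \<in> weighted_L2 lam"
    and eq: "\<And>s. 0 < s \<Longrightarrow> - \<phi>' s = transpose A *v \<phi> s + exp (- lam * s) *\<^sub>R (y s - yd)"
    using assms by (auto simp: is_adjoint_state_def)
  have "(\<lambda>s. exp (lam * s) *\<^sub>R (- \<phi>' s - transpose A *v \<phi> s)) \<in> weighted_L2 (- lam)"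
    by (intro weighted_L2_exp_scaleR weighted_L2_diff weighted_L2_uminus weighted_L2_matrix_vector_mult \<phi>)
  then show ?thesis
  proof (rule weighted_L2_cong)
    show "exp (lam * s) *\<^sub>R (- \<phi>' s - transpose A *v \<phi> s) = y s - yd" if "0 < s" for s
      using eq[OF that] by (simp add: exp_minus)
  qed
qed

theorem theorem5p3:
  fixes A :: "real^'d^'d" and B :: "real^'m^'d"
    and x yd :: "real^'d"
    and U :: "(real^'m) set"
    and p q \<gamma> lam :: real
    and t :: "nat \<Rightarrow> real"
    and ubar :: "real \<Rightarrow> real^'m"
    and phibar :: "real \<Rightarrow> real^'d"
  assumes "0 < p" and "p < 1" and "p \<le> q" and "q \<le> 1" and "0 < \<gamma>"
    and "compact U" and "convex U"
    and "t 0 = 0" and "strict_mono t" and "filterlim t at_top sequentially"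
    and "lam > max 0 (2 * spectral_abscissa A)"
    and "ubar \<in> grid_controls t U"
    and "is_adjoint_state A yd lam (trajectory A B x ubar) phibar"
    and "\<And>k s. s \<in> cell t k \<Longrightarrow>
           is_arg_min
             (\<lambda>u. (LINT r:cell t k|lborel. phibar r \<bullet> (B *v u)) + \<gamma> * weight lam t k * lp_norm p u powr q)
             (\<lambda>u. u \<in> U) (ubar s)"
  shows "\<forall>u\<in>grid_controls t U.
           cost A B yd lam \<gamma> p q t x u \<ge> cost A B yd lam \<gamma> p q t x ubar"
proof
  fix u assume u: "u \<in> grid_controls t U"
  interpret time_grid t by unfold_locales (use assms in auto)
  have lam: "0 < lam" using assms(11) by simp
  note ubar = assms(12)
  define J where "J v = cost A B yd lam \<gamma> p q t x v" for v
  define y where "y = trajectory A B x ubar"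
  define z where "z = trajectory A B x u"
  define w where "w s = z s - y s" for s
  define v where "v s = u s - ubar s" for s
  define w' where "w' s = A *v w s + B *v v s" for s
  define b where "b c k = weight lam t k * (\<Sum>i\<in>UNIV. \<bar>c (t k) $ i\<bar> powr p) powr (q / p)"
    for c :: "real \<Rightarrow> real^'m" and k
  define a where "a y s = 1/2 * exp (- lam * s) * (norm (y s - yd))\<^sup>2"
    for y :: "real \<Rightarrow> real^'d" and s
  have b_nonneg: "0 \<le> b c k" for c k by (simp add: b_def weight_nonneg)
  obtain \<phi>' where \<phi>: "phibar \<in> weighted_L2 lam" and \<phi>': "\<phi>' \<in> weighted_L2 lam"
    and d\<phi>: "\<And>s. 0 < s \<Longrightarrow> (phibar has_vector_derivative \<phi>' s) (at s)"
    and adj: "\<And>s. 0 < s \<Longrightarrow> - \<phi>' s = transpose A *v phibar s + exp (- lam * s) *\<^sub>R (y s - yd)"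
    using assms(13) by (auto simp: is_adjoint_state_def y_def)
  have yL: "(\<lambda>s. y s - yd) \<in> weighted_L2 (- lam)"
    unfolding y_def by (rule adjoint_state_weighted_L2[OF assms(13)])
  have "J ubar \<le> J u"
  \<comment> \<open>An infinite cost of \<open>u\<close> leaves nothing to show; a finite one makes
    the state and the penalty of \<open>u\<close> integrable and summable.\<close>
  proof (cases "J u = \<infinity>")
    case False
    have zL: "(\<lambda>s. z s - yd) \<in> weighted_L2 (- lam)"
      unfolding z_def using False by (intro weighted_L2_if_finite_cost[OF u]) (simp add: J_def)
    have wL: "w \<in> weighted_L2 (- lam)"
      using weighted_L2_diff[OF zL yL] by (simp add: w_def[abs_def])
    obtain M where M: "\<And>c. c \<in> U \<Longrightarrow> norm c \<le> M"
      using compact_imp_bounded[OF assms(6)] by (auto simp: bounded_iff)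
    have controlL: "c \<in> weighted_L2 (- lam)" if "c \<in> grid_controls t U" for c
      using that by (intro weighted_L2_bounded[OF lam grid_control_measurable[OF that], of M] M)
        (simp add: grid_controls_def)
    have vL: "v \<in> weighted_L2 (- lam)"
      unfolding v_def[abs_def] by (intro weighted_L2_diff controlL u ubar)
    have w'L: "w' \<in> weighted_L2 (- lam)"
      unfolding w'_def[abs_def] by (intro weighted_L2_add weighted_L2_matrix_vector_mult wL vL)
    have traj: "is_trajectory A B x u z" "is_trajectory A B x ubar y"
      unfolding y_def z_def by (rule grid_trajectory[OF u], rule grid_trajectory[OF ubar])
    have "(LINT s:{0<..}|lborel. phibar s \<bullet> w' s + \<phi>' s \<bullet> w s) = 0"
    proof (rule integral_by_parts_eq_0[OF lam \<phi> \<phi>' d\<phi> wL w'L])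
      show "(w has_vector_derivative w' s) (at s)" if "0 < s" "s \<notin> range t" for s
      proof -
        have "(w has_vector_derivative (A *v z s + B *v u s) - (A *v y s + B *v ubar s)) (at s)"
          unfolding w_def[abs_def] using that
          by (intro has_vector_derivative_diff is_trajectory_has_vector_derivative[OF traj(1)]
              is_trajectory_has_vector_derivative[OF traj(2)] grid_control_isCont[OF u] grid_control_isCont[OF ubar]) auto
        then show ?thesis
          by (simp add: w'_def w_def v_def matrix_vector_mult_diff_distrib algebra_simps)
      qed
      show "continuous_on {0..} w"
        unfolding w_def[abs_def]
        by (intro continuous_intros is_trajectory_continuous_on_atLeast[OF traj(1)]
            is_trajectory_continuous_on_atLeast[OF traj(2)])
      have "z 0 = x" "y 0 = x"
        by (rule is_trajectory_start[OF traj(1)], rule is_trajectory_start[OF traj(2)])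
      then show "w 0 = 0" by (simp add: w_def)
    qed
    define R where "R = (LINT s:{0<..}|lborel. phibar s \<bullet> (B *v v s))"
    \<comment> \<open>The subtracted expression has integral zero, so \<open>h\<close> also
      integrates to \<open>R\<close>. Inserting the state and adjoint equations cancels the terms
      with \<open>A\<close> and leaves the directional derivative of the tracking term.\<close>
    define h where "h s = phibar s \<bullet> (B *v v s) - (phibar s \<bullet> w' s + \<phi>' s \<bullet> w s)" for s
    have int: "set_integrable lborel {0<..} (\<lambda>s. phibar s \<bullet> (B *v v s))"
        "set_integrable lborel {0<..} (\<lambda>s. phibar s \<bullet> w' s + \<phi>' s \<bullet> w s)"
      by (intro set_integral_add(1) weighted_L2_inner_integrable[OF \<phi>]
          weighted_L2_inner_integrable[OF \<phi>'] weighted_L2_matrix_vector_mult vL wL w'L)+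
    have h: "set_integrable lborel {0<..} h" and R: "R = (LINT s:{0<..}|lborel. h s)"
      using int \<open>(LINT s:{0<..}|lborel. phibar s \<bullet> w' s + \<phi>' s \<bullet> w s) = 0\<close>
      by (auto simp: h_def[abs_def] R_def)
    have h_eq: "h s = exp (- lam * s) * ((y s - yd) \<bullet> w s)" if "0 < s" for s
    proof -
      have "(transpose A *v phibar s) \<bullet> w s = phibar s \<bullet> (A *v w s)"
        by (metis dot_lmul_matrix transpose_matrix_vector)
      moreover have "- \<phi>' s \<bullet> w s =
          (transpose A *v phibar s + exp (- lam * s) *\<^sub>R (y s - yd)) \<bullet> w s"
        using adj[OF that] by simp
      ultimately show ?thesis by (simp add: h_def w'_def inner_add_left inner_add_right)
    qed
    have aint: "set_integrable lborel {0<..} (a y)" if "(\<lambda>s. y s - yd) \<in> weighted_L2 (- lam)" for y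
    proof -
      have "set_integrable lborel {0<..} (\<lambda>s. 1/2 * (exp (- lam * s) * (norm (y s - yd))\<^sup>2))"
        using that by (intro set_integrable_mult_right) (auto simp: weighted_L2_iff)
      then show ?thesis by (simp only: a_def[abs_def] mult.assoc)
    qed
    \<comment> \<open>This is convexity of the tracking term: expanding the square around
      \<open>y s - yd\<close> gives \<open>h s\<close> as linear part and a nonnegative
      remainder.\<close>
    have "(LINT s:{0<..}|lborel. a y s + h s) \<le> (LINT s:{0<..}|lborel. a z s)"
    proof (rule set_integral_mono)
      show "set_integrable lborel {0<..} (\<lambda>s. a y s + h s)"
        by (intro set_integral_add(1) aint[OF yL] h)
      show "set_integrable lborel {0<..} (a z)" by (rule aint[OF zL])
      fix s :: real assume "s \<in> {0<..}"
      then have hs: "h s = exp (- lam * s) * ((y s - yd) \<bullet> w s)" by (intro h_eq) simp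
      have "(norm (z s - yd))\<^sup>2 = (norm ((y s - yd) + w s))\<^sup>2" by (simp add: w_def)
      also have "\<dots> = (norm (y s - yd))\<^sup>2 + 2 * ((y s - yd) \<bullet> w s) + (norm (w s))\<^sup>2"
        by (simp add: power2_norm_eq_inner inner_add_left inner_add_right inner_commute)
      finally have sq: "(norm (z s - yd))\<^sup>2 =
          (norm (y s - yd))\<^sup>2 + 2 * ((y s - yd) \<bullet> w s) + (norm (w s))\<^sup>2" .
      have "a z s = a y s + h s + 1/2 * exp (- lam * s) * (norm (w s))\<^sup>2"
        unfolding hs a_def sq by (simp add: algebra_simps)
      then show "a y s + h s \<le> a z s" by simp
    qed
    then have state: "(LINT s:{0<..}|lborel. a y s) + R \<le> (LINT s:{0<..}|lborel. a z s)"
      using aint[OF yL] h R by simp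
    define S where "S N = (\<Sum>k<N. LINT s:cell t k|lborel. phibar s \<bullet> (B *v v s))" for N
    have S: "S \<longlonglongrightarrow> R"
      unfolding S_def[abs_def] R_def by (rule cell_integrals_tendsto[OF int(1)])
    \<comment> \<open>The competitor in the minimization on the k-th cell is the constant value
      \<open>u (t k)\<close>. Both controls are constant there, so the difference of the linear
      terms is the integral of the pairing with \<open>v\<close>.\<close>
    have step: "\<gamma> * b ubar k \<le> \<gamma> * b u k + (LINT s:cell t k|lborel. phibar s \<bullet> (B *v v s))" for k
    proof -
      define I where "I c = (LINT r:cell t k|lborel. phibar r \<bullet> (B *v c))" for c
      have lp: "lp_norm p c powr q = (\<Sum>i\<in>UNIV. \<bar>c $ i\<bar> powr p) powr (q / p)" for c :: "real^'m"
        by (simp add: lp_norm_def powr_powr)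
      have "u (t k) \<in> U" using u grid_nonneg by (simp add: grid_controls_def)
      then have "I (ubar (t k)) + \<gamma> * b ubar k \<le> I (u (t k)) + \<gamma> * b u k"
        using assms(14)[OF grid_in_cell[of k]]
        by (auto simp: is_arg_min_def I_def b_def lp not_less mult.assoc)
      moreover have "(LINT s:cell t k|lborel. phibar s \<bullet> (B *v v s)) = I (u (t k)) - I (ubar (t k))"
      proof -
        have Iint: "set_integrable lborel (cell t k) (\<lambda>r. phibar r \<bullet> (B *v c))" for c
        proof -
          have "set_integrable lborel {0<..} (\<lambda>r. phibar r \<bullet> (B *v c))"
            by (intro weighted_L2_inner_integrable[OF \<phi>] weighted_L2_bounded[OF lam, of _ "norm (B *v c)"])
              (auto simp: set_borel_measurable_def)
          moreover have "set_integrable lborel {0<..} (\<lambda>r. phibar r \<bullet> (B *v c)) \<longleftrightarrow>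
              set_integrable lborel {0..} (\<lambda>r. phibar r \<bullet> (B *v c))"
            by (rule set_integrable_discrete_difference[of "{0}"]) auto
          ultimately have "set_integrable lborel {0..} (\<lambda>r. phibar r \<bullet> (B *v c))" by simp
          then show ?thesis
            by (rule set_integrable_subset) (use grid_nonneg[of k] in \<open>auto simp: cell_def\<close>)
        qed
        have "(LINT s:cell t k|lborel. phibar s \<bullet> (B *v v s)) =
            (LINT s:cell t k|lborel. phibar s \<bullet> (B *v u (t k)) - phibar s \<bullet> (B *v ubar (t k)))"
          using grid_control_eq[OF u] grid_control_eq[OF ubar]
          by (intro set_lebesgue_integral_cong)
            (auto simp: v_def cell_def matrix_vector_mult_diff_distrib inner_diff_right)
        then show ?thesis using Iint by (simp add: I_def)
      qed
      ultimately show ?thesis by simp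
    qed
    have sum_u: "summable (b u)"
      unfolding b_def using False assms(5) by (intro summable_if_finite_cost) (auto simp: J_def)
    have partial: "\<gamma> * (\<Sum>k<N. b ubar k) \<le> \<gamma> * (\<Sum>k<N. b u k) + S N" for N
      unfolding S_def sum_distrib_left sum.distrib[symmetric] by (intro sum_mono step)
    \<comment> \<open>Convergence of \<open>S\<close> bounds it from above. Together with the
      summable penalty of \<open>u\<close> this bounds the partial sums of the penalty of
      \<open>ubar\<close>, which have nonnegative terms and therefore converge.\<close>
    obtain K where K: "\<And>N. S N \<le> K"
      using convergent_imp_Bseq[OF convergentI[OF S]] unfolding Bseq_def
      by (metis abs_le_D1 real_norm_def)
    have "(\<Sum>k<N. b ubar k) \<le> (\<Sum>k. b u k) + K / \<gamma>" for N
    proof -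
      have "(\<Sum>k<N. b u k) \<le> (\<Sum>k. b u k)"
        by (rule sum_le_suminf[OF sum_u]) (auto simp: b_nonneg)
      then have "\<gamma> * (\<Sum>k<N. b u k) \<le> \<gamma> * (\<Sum>k. b u k)"
        using assms(5) by (intro mult_left_mono) auto
      then have "\<gamma> * (\<Sum>k<N. b ubar k) \<le> \<gamma> * (\<Sum>k. b u k) + K"
        using partial[of N] K[of N] by linarith
      then show ?thesis using assms(5) by (simp add: field_simps)
    qed
    then have sum_ubar: "summable (b ubar)" by (rule summableI_nonneg_bounded[OF b_nonneg])
    have "\<gamma> * (\<Sum>k. b ubar k) \<le> \<gamma> * (\<Sum>k. b u k) + R"
      using partial
      by (intro LIMSEQ_le[OF tendsto_mult_left[OF summable_LIMSEQ[OF sum_ubar]]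
            tendsto_add[OF tendsto_mult_left[OF summable_LIMSEQ[OF sum_u]] S]]) blast
    \<comment> \<open>Adding the tracking and the penalty inequalities cancels
      \<open>R\<close>.\<close>
    with state have "(LINT s:{0<..}|lborel. a y s) + \<gamma> * (\<Sum>k. b ubar k) \<le>
        (LINT s:{0<..}|lborel. a z s) + \<gamma> * (\<Sum>k. b u k)" by simp
    moreover have "J ubar = ennreal ((LINT s:{0<..}|lborel. a y s) + \<gamma> * (\<Sum>k. b ubar k))"
      using cost_eq_ennreal[of A B x ubar yd lam \<gamma> p q] yL sum_ubar assms(5)
      by (simp add: J_def a_def b_def[abs_def] y_def)
    moreover have "J u = ennreal ((LINT s:{0<..}|lborel. a z s) + \<gamma> * (\<Sum>k. b u k))"
      using cost_eq_ennreal[of A B x u yd lam \<gamma> p q] zL sum_u assms(5)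
      by (simp add: J_def a_def b_def[abs_def] z_def)
    ultimately show ?thesis by (simp add: ennreal_leI)
  qed simp
  then show "cost A B yd lam \<gamma> p q t x ubar \<le> cost A B yd lam \<gamma> p q t x u"
    by (simp add: J_def)
qed

end
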